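(* Let $F$ be a finite simple graph with $m=|E(F)|\ge 1$, and let $W$ be a graphon. Suppose $a\le W\le 1$ almost everywhere, where $a\in(0,1]$, and put $M:=\log(1/a)$. Then, with $\bar u:=\int_{[0,1]^2}\log W$, $$\|\log W-\bar u\|_2^2\le\frac1m\left(2e^{mM}+m^2M^2\right)M\,\Delta_F(W).$$ Consequently, if $p:=e^{\bar u}$, then $$\max\left\{\|W-p\|_1^2,\ \|W-p\|_2^2\right\}\le\frac1m\left(2e^{mM}+m^2M^2\right)M\,\Delta_F(W).$$
   Context: A graphon is a symmetric measurable function $W\colon[0,1]^2\to[0,1]$. Integrals are with respect to Lebesgue measure, and $\|\cdot\|_1,\|\cdot\|_2$ are the $L^1$ and $L^2$ norms on $[0,1]^2$. For a finite simple graph $F=(V,E)$, $$t(F,W):=\int_{[0,1]^V}\prod_{ij\in E}W(x_i,x_j)\prod_{i\in V}dx_i.$$ For an edge $e=ab\in E$, the edge-rooted density is $$r_e^W(x,y):=\int_{[0,1]^{V\setminus\{a,b\}}}\prod_{ij\in E}W(z_i,z_j)\prod_{i\in V\setminus\{a,b\}}dz_i,\qquad z_a=x,\ z_b=y.$$ When $t(F,W)>0$ (which holds here since $W\ge a>0$), the normalized edge marginal is $q_e^W:=r_e^W/t(F,W)$ and the total marginal error is $$\Delta_F(W):=\sum_{e\in E(F)}\|q_e^W-1\|_{L^1([0,1]^2)}.$$ *)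

theory Defs
  imports "HOL-Analysis.Analysis"
begin

definition simple_graph :: "'v set \<Rightarrow> 'v set set \<Rightarrow> bool" where
  "simple_graph V E \<longleftrightarrow> finite V \<and> (\<forall>e\<in>E. e \<subseteq> V \<and> card e = 2)"

abbreviation unit_square :: "(real \<times> real) set" where
  "unit_square \<equiv> {0..1} \<times> {0..1}"

text \<open>Functions on the unit square are total functions on \<open>real \<times> real\<close>; only their
  values on the square matter.  Measurable means Lebesgue measurable.\<close>

definition graphon :: "(real \<times> real \<Rightarrow> real) \<Rightarrow> bool" where
  "graphon W \<longleftrightarrow>
     W \<in> borel_measurable (lebesgue_on unit_square) \<and>
     (\<forall>x\<in>{0..1}. \<forall>y\<in>{0..1}. W (x, y) = W (y, x)) \<and>
     (\<forall>x\<in>{0..1}. \<forall>y\<in>{0..1}. 0 \<le> W (x, y) \<and> W (x, y) \<le> 1)"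

definition L1_norm :: "(real \<times> real \<Rightarrow> real) \<Rightarrow> real" where
  "L1_norm f = (LINT z|lebesgue_on unit_square. \<bar>f z\<bar>)"

definition L2_norm :: "(real \<times> real \<Rightarrow> real) \<Rightarrow> real" where
  "L2_norm f = sqrt (LINT z|lebesgue_on unit_square. (f z)\<^sup>2)"

text \<open>Lebesgue measure on the cube of functions \<open>V \<rightarrow> [0,1]\<close>.  The completion is needed
  because for a Lebesgue measurable \<open>W\<close> the map sending \<open>x\<close> to \<open>W (x i, x j)\<close> need not be
  measurable for the product sigma-algebra itself.\<close>

definition cube_measure :: "'v set \<Rightarrow> ('v \<Rightarrow> real) measure" where
  "cube_measure V = completion (Pi\<^sub>M V (\<lambda>_. restrict_space lborel {0..1}))"

text \<open>An arbitrary but fixed ordering of the two endpoints of an edge.  By symmetry of \<open>W\<close>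
  nothing below depends on it: see \<open>graphon_ends\<close> for the factors of the edge product and
  \<open>edge_rooted_density_swap\<close> for the edge-rooted densities, where exchanging the endpoints
  only exchanges the two arguments and so does not affect the norm.\<close>

definition ends :: "'v set \<Rightarrow> 'v \<times> 'v" where
  "ends e = (SOME (i, j). e = {i, j})"

definition edge_product :: "'v set set \<Rightarrow> (real \<times> real \<Rightarrow> real) \<Rightarrow> ('v \<Rightarrow> real) \<Rightarrow> real" where
  "edge_product E W x = (\<Prod>e\<in>E. case ends e of (i, j) \<Rightarrow> W (x i, x j))"

definition hom_density :: "'v set \<Rightarrow> 'v set set \<Rightarrow> (real \<times> real \<Rightarrow> real) \<Rightarrow> real" where
  "hom_density V E W = (LINT x|cube_measure V. edge_product E W x)"

definition edge_rooted_density ::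
  "'v set \<Rightarrow> 'v set set \<Rightarrow> (real \<times> real \<Rightarrow> real) \<Rightarrow> 'v \<times> 'v \<Rightarrow> real \<times> real \<Rightarrow> real" where
  "edge_rooted_density V E W = (\<lambda>(a, b) (x, y).
     LINT z|cube_measure (V - {a, b}). edge_product E W (z(a := x, b := y)))"

definition edge_marginal ::
  "'v set \<Rightarrow> 'v set set \<Rightarrow> (real \<times> real \<Rightarrow> real) \<Rightarrow> 'v \<times> 'v \<Rightarrow> real \<times> real \<Rightarrow> real" where
  "edge_marginal V E W ab xy = edge_rooted_density V E W ab xy / hom_density V E W"

definition marginal_error :: "'v set \<Rightarrow> 'v set set \<Rightarrow> (real \<times> real \<Rightarrow> real) \<Rightarrow> real" where
  "marginal_error V E W = (\<Sum>e\<in>E. L1_norm (\<lambda>xy. edge_marginal V E W (ends e) xy - 1))"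

lemma ends_eq:
  assumes "card e = 2" and "ends e = (i, j)"
  shows "e = {i, j}" and "i \<noteq> j"
proof -
  have "\<exists>p. case p of (i, j) \<Rightarrow> e = {i, j}"
    using assms(1) by (auto simp: card_2_iff)
  then have "case ends e of (i, j) \<Rightarrow> e = {i, j}"
    unfolding ends_def by (rule someI_ex)
  then show "e = {i, j}" using assms(2) by simp
  then show "i \<noteq> j" using assms(1) by auto
qed

lemma graphon_ends:
  assumes "graphon W" and "i \<noteq> j" and "x i \<in> {0..1}" and "x j \<in> {0..1}"
  shows "(case ends {i, j} of (k, l) \<Rightarrow> W (x k, x l)) = W (x i, x j)"
proof -
  obtain k l where kl: "ends {i, j} = (k, l)" by fastforce
  have "card {i, j} = 2" using assms(2) by simp
  then have "{i, j} = {k, l}" using kl by (rule ends_eq(1))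
  then consider "k = i" "l = j" | "k = j" "l = i" by (metis doubleton_eq_iff)
  then show ?thesis
  proof cases
    case 1
    then show ?thesis by (simp add: kl)
  next
    case 2
    have "W (x j, x i) = W (x i, x j)"
      using assms(1,3,4) unfolding graphon_def by blast
    then show ?thesis by (simp add: kl 2)
  qed
qed

lemma edge_rooted_density_swap:
  assumes "a \<noteq> b"
  shows "edge_rooted_density V E W (b, a) (y, x) = edge_rooted_density V E W (a, b) (x, y)"
proof -
  have "z(b := y, a := x) = z(a := x, b := y)" for z :: "'a \<Rightarrow> real"
    using assms by (rule fun_upd_twist[OF not_sym])
  then show ?thesis by (simp add: edge_rooted_density_def insert_commute[of b a])
qed

end

theory Submission
  imports Defs "HOL-Probability.Infinite_Product_Measure"
begin

text \<open>
  Put \<open>U = ln W\<close>, \<open>h = U - u\<close> and, for \<open>x\<close> in the cube \<open>[0,1]\<^sup>V\<close>, let \<open>S x\<close> be the sum of the values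
  of \<open>U\<close> over the edges, so that the integrand of the homomorphism density \<open>t\<close> is \<open>exp S\<close>.
  The argument estimates \<open>I\<close>, the integral of \<open>(S - m u) exp S\<close>, from both sides.

  From above: \<open>S - m u\<close> is the sum of the values of \<open>h\<close> over the edges. Integrating out
  all coordinates except the ends of \<open>e\<close> turns the contribution of \<open>e\<close> into the integral of
  \<open>h r\<^sub>e\<close>, where \<open>r\<^sub>e\<close> is the edge-rooted density; since \<open>h\<close> has mean zero this is the integral
  of \<open>h (r\<^sub>e - t)\<close>. As \<open>\<bar>h\<bar> \<le> M\<close> and \<open>t \<le> 1\<close>, it is at most \<open>M\<close> times the \<open>L\<^sup>1\<close> norm of
  \<open>r\<^sub>e / t - 1\<close>. Hence \<open>I \<le> M \<Delta>\<close>.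

  From below: \<open>m u\<close> is the mean of \<open>S\<close>, so \<open>I\<close> is the covariance of \<open>S\<close> and \<open>exp S\<close>. Since
  \<open>S \<ge> - m M\<close>, the exponential increases at rate at least \<open>exp (- m M)\<close>, and the covariance is at
  least \<open>exp (- m M)\<close> times the variance of \<open>S\<close> (lemma \<open>exp_tilt_ge_variance\<close>).
  Finally, the variance of \<open>S\<close> is at least \<open>m\<close> times the integral of \<open>h\<^sup>2\<close>, because the
  values of \<open>h\<close> at two edges are never negatively correlated (lemma \<open>pair_correlation_nonneg\<close>):
  disjoint edges are independent, and for two edges with one common vertex the correlation is the
  integral of the square of the degree function of \<open>h\<close>.

  Together, \<open>m\<close> times the integral of \<open>h\<^sup>2\<close> is at most \<open>exp (m M) M \<Delta>\<close>, which implies the stated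
  bound. The bounds on \<open>W - p\<close> follow because \<open>exp\<close> is a contraction on the nonpositive reals and
  the \<open>L\<^sup>1\<close> norm is at most the \<open>L\<^sup>2\<close> norm.

  The analysis takes place in powers of an arbitrary probability space, for a kernel that is
  measurable for the product sigma-algebra. A graphon is only Lebesgue measurable, so it is first
  replaced by an almost everywhere equal Borel kernel that is still symmetric.
\<close>

section \<open>Integrals with respect to a completed measure\<close>

text \<open>Completeness makes \<open>f\<close> measurable, since it differs from \<open>g\<close> only on a null set.\<close>

lemma integral_completion_AE_cong:
  fixes f g :: "'a \<Rightarrow> real"
  assumes g: "g \<in> borel_measurable M" and eq: "AE x in M. f x = g x"
  shows "(LINT x|completion M. f x) = (LINT x|M. g x)"
proof -
  interpret completion: complete_measure "completion M" by (rule completion.complete_measure_axioms)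
  have g': "g \<in> borel_measurable (completion M)" using g by (rule measurable_completion)
  have eq': "AE x in completion M. f x = g x" using eq by (rule AE_completion)
  have "f \<in> borel_measurable (completion M)"
  proof (rule measurableI)
    fix A :: "real set" assume A: "A \<in> sets borel"
    have B: "g -` A \<inter> space (completion M) \<in> sets (completion M)"
      using g' A by (rule measurable_sets)
    have "AE x in completion M. (x \<in> g -` A \<inter> space (completion M)) = (x \<in> f -` A \<inter> space (completion M))"
      using eq' by eventually_elim auto
    then show "f -` A \<inter> space (completion M) \<in> sets (completion M)"
      using B completion.in_sets_AE by blast
  qed simp
  then have "(LINT x|completion M. f x) = (LINT x|completion M. g x)"
    using g' eq' by (intro integral_cong_AE) auto
  then show ?thesis using g by (simp add: integral_completion)
qed

section \<open>Separating the two ends of an edge in a finite power\<close>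

lemma map_prod_eq_Pair: "map_prod f g q = (f (fst q), g (snd q))"
  by (cases q) simp

context prob_space
begin

lemma measurable_upd_pair:
  assumes "i \<in> V" "j \<in> V"
  shows "(\<lambda>((x, y), z). z(i := x, j := y)) \<in>
    measurable ((M \<Otimes>\<^sub>M M) \<Otimes>\<^sub>M PiM (V - {i, j}) (\<lambda>_. M)) (PiM V (\<lambda>_. M))"
  unfolding split_beta' using assms
  by (intro measurable_fun_upd[where J = "insert i (V - {i, j})"]
      measurable_fun_upd[where J = "V - {i, j}"]) auto

text \<open>Fubini's theorem in the form in which edge-rooted densities are defined: the coordinates
  \<open>i\<close> and \<open>j\<close> are drawn first and written over an independent sample of the others.\<close>

lemma PiM_split_pair:
  assumes "finite V" "i \<in> V" "j \<in> V" "i \<noteq> j"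
  shows "distr ((M \<Otimes>\<^sub>M M) \<Otimes>\<^sub>M PiM (V - {i, j}) (\<lambda>_. M)) (PiM V (\<lambda>_. M))
      (\<lambda>((x, y), z). z(i := x, j := y)) = PiM V (\<lambda>_. M)"
    (is "distr ?Q ?P ?g = _")
proof -
  have upd: "?g \<in> measurable ?Q ?P"
    using assms by (intro measurable_upd_pair)
  have Times: "emeasure (M \<Otimes>\<^sub>M M) (A \<times> B) = emeasure M A * emeasure M B"
    if "A \<in> sets M" "B \<in> sets M" for A B
    using that by (rule emeasure_pair_measure_Times)
  interpret product_prob_space "\<lambda>_. M" V ..
  interpret R: finite_product_prob_space "\<lambda>_. M" "V - {i, j}"
    by standard (use assms in auto)
  interpret MM: pair_prob_space M M ..
  interpret Q: pair_prob_space "M \<Otimes>\<^sub>M M" "PiM (V - {i, j}) (\<lambda>_. M)" ..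
  have V: "V = insert j (insert i (V - {i, j}))" using assms by auto
  show ?thesis
  proof (rule PiM_eqI)
    fix A assume A: "\<And>k. k \<in> V \<Longrightarrow> A k \<in> sets M"
    have "?g -` Pi\<^sub>E V A \<inter> space ?Q = (A i \<times> A j) \<times> Pi\<^sub>E (V - {i, j}) A"
    proof (intro set_eqI iffI)
      fix s assume "s \<in> ?g -` Pi\<^sub>E V A \<inter> space ?Q"
      moreover obtain x y z where "s = ((x, y), z)" by (metis prod.exhaust)
      ultimately have z: "z(i := x, j := y) \<in> Pi\<^sub>E V A" "z \<in> space (PiM (V - {i, j}) (\<lambda>_. M))"
        by (auto simp: space_pair_measure)
      have "x \<in> A i" "y \<in> A j"
        using PiE_mem[OF z(1), of i] PiE_mem[OF z(1), of j] assms by auto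
      moreover have "z \<in> Pi\<^sub>E (V - {i, j}) A"
      proof (rule PiE_I)
        fix k assume "k \<in> V - {i, j}" then show "z k \<in> A k"
          using PiE_mem[OF z(1), of k] by auto
      next
        fix k assume "k \<notin> V - {i, j}" then show "z k = undefined"
          using z(2) by (auto simp: space_PiM PiE_def extensional_def)
      qed
      ultimately show "s \<in> (A i \<times> A j) \<times> Pi\<^sub>E (V - {i, j}) A"
        using \<open>s = _\<close> by auto
    next
      fix s assume "s \<in> (A i \<times> A j) \<times> Pi\<^sub>E (V - {i, j}) A"
      then obtain x y z where s: "s = ((x, y), z)" "x \<in> A i" "y \<in> A j" "z \<in> Pi\<^sub>E (V - {i, j}) A"
        by auto
      have "z(i := x, j := y) \<in> Pi\<^sub>E V A"
        using s assms by (auto simp: PiE_def extensional_def Pi_def)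
      moreover have "x \<in> space M" "y \<in> space M" "z \<in> space (PiM (V - {i, j}) (\<lambda>_. M))"
        using s A assms by (auto simp: space_PiM PiE_def Pi_def dest: sets.sets_into_space)
      ultimately show "s \<in> ?g -` Pi\<^sub>E V A \<inter> space ?Q"
        using s by (auto simp: space_pair_measure)
    qed
    then have "emeasure (distr ?Q ?P ?g) (Pi\<^sub>E V A)
        = emeasure ?Q ((A i \<times> A j) \<times> Pi\<^sub>E (V - {i, j}) A)"
      using upd A assms by (subst emeasure_distr) (auto intro!: sets_PiM_I_finite)
    also have "\<dots> = emeasure M (A i) * emeasure M (A j) * (\<Prod>k\<in>V - {i, j}. emeasure M (A k))"
    proof -
      have "emeasure (M \<Otimes>\<^sub>M M) (A i \<times> A j) = emeasure M (A i) * emeasure M (A j)"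
        using A assms by (intro Times) auto
      moreover have "emeasure (PiM (V - {i, j}) (\<lambda>_. M)) (Pi\<^sub>E (V - {i, j}) A)
          = (\<Prod>k\<in>V - {i, j}. emeasure M (A k))"
        using A assms by (intro emeasure_PiM) auto
      ultimately show ?thesis
        using A assms by (subst R.emeasure_pair_measure_Times) (auto intro!: sets_PiM_I_finite)
    qed
    also have "\<dots> = (\<Prod>k\<in>V. emeasure M (A k))"
      using assms by (subst (2) V) (simp add: mult_ac)
    finally show "emeasure (distr ?Q ?P ?g) (Pi\<^sub>E V A) = (\<Prod>k\<in>V. emeasure M (A k))" .
  qed (use assms in auto)
qed


lemma borel_measurable_PiM_edge:
  assumes "f \<in> borel_measurable (M \<Otimes>\<^sub>M M)" "fst q \<in> V" "snd q \<in> V"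
  shows "(\<lambda>x. f (map_prod x x q)) \<in> borel_measurable (PiM V (\<lambda>_. M))"
proof -
  note [measurable] = assms
  show ?thesis unfolding map_prod_eq_Pair by measurable
qed

lemma borel_measurable_rooted_integral:
  fixes G :: "('v \<Rightarrow> 'a) \<Rightarrow> real"
  assumes "i \<in> V" "j \<in> V" "G \<in> borel_measurable (PiM V (\<lambda>_. M))"
  shows "(\<lambda>p. LINT z|PiM (V - {i, j}) (\<lambda>_. M). G (z(i := fst p, j := snd p)))
    \<in> borel_measurable (M \<Otimes>\<^sub>M M)"
proof -
  interpret R: prob_space "PiM (V - {i, j}) (\<lambda>_. M)"
    by (intro prob_space_PiM prob_space_axioms)
  show ?thesis
    using measurable_compose[OF measurable_upd_pair assms(3)] assms(1,2)
    by (intro R.borel_measurable_lebesgue_integral) (simp add: split_beta')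
qed

lemma distr_PiM_pair:
  assumes "finite V" "i \<in> V" "j \<in> V" "i \<noteq> j"
  shows "distr (PiM V (\<lambda>_. M)) (M \<Otimes>\<^sub>M M) (\<lambda>x. (x i, x j)) = M \<Otimes>\<^sub>M M"
proof -
  interpret R: prob_space "PiM (V - {i, j}) (\<lambda>_. M)"
    by (intro prob_space_PiM prob_space_axioms)
  let ?Q = "(M \<Otimes>\<^sub>M M) \<Otimes>\<^sub>M PiM (V - {i, j}) (\<lambda>_. M)"
  have "distr (PiM V (\<lambda>_. M)) (M \<Otimes>\<^sub>M M) (\<lambda>x. (x i, x j))
      = distr ?Q (M \<Otimes>\<^sub>M M) ((\<lambda>x. (x i, x j)) \<circ> (\<lambda>((x, y), z). z(i := x, j := y)))"
    using assms
    by (subst PiM_split_pair[OF assms, symmetric], intro distr_distr measurable_upd_pair) auto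
  also have "(\<lambda>x. (x i, x j)) \<circ> (\<lambda>((x, y), z). z(i := x, j := y)) = fst"
    using assms by auto
  also have "distr ?Q (M \<Otimes>\<^sub>M M) fst = M \<Otimes>\<^sub>M M"
    by (rule R.distr_pair_fst)
  finally show ?thesis .
qed

lemma integral_PiM_pair:
  fixes f :: "'a \<times> 'a \<Rightarrow> real"
  assumes "finite V" "i \<in> V" "j \<in> V" "i \<noteq> j" "f \<in> borel_measurable (M \<Otimes>\<^sub>M M)"
  shows "(LINT x|PiM V (\<lambda>_. M). f (x i, x j)) = (LINT p|(M \<Otimes>\<^sub>M M). f p)"
proof -
  have "(LINT p|(M \<Otimes>\<^sub>M M). f p)
      = (LINT p|distr (PiM V (\<lambda>_. M)) (M \<Otimes>\<^sub>M M) (\<lambda>x. (x i, x j)). f p)"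
    by (simp add: distr_PiM_pair[OF assms(1-4)])
  also have "\<dots> = (LINT x|PiM V (\<lambda>_. M). f (x i, x j))"
    using assms by (intro integral_distr) auto
  finally show ?thesis by simp
qed

lemma integral_PiM_split_pair:
  fixes F :: "('v \<Rightarrow> 'a) \<Rightarrow> real" and f :: "'a \<times> 'a \<Rightarrow> real"
  assumes V: "finite V" "i \<in> V" "j \<in> V" "i \<noteq> j"
    and F: "F \<in> borel_measurable (PiM V (\<lambda>_. M))"
      "\<And>x. x \<in> space (PiM V (\<lambda>_. M)) \<Longrightarrow> \<bar>F x\<bar> \<le> C"
    and f: "f \<in> borel_measurable (M \<Otimes>\<^sub>M M)" "\<And>p. p \<in> space (M \<Otimes>\<^sub>M M) \<Longrightarrow> \<bar>f p\<bar> \<le> D"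
  shows "(LINT x|PiM V (\<lambda>_. M). f (x i, x j) * F x)
    = (LINT p|(M \<Otimes>\<^sub>M M). f p * (LINT z|PiM (V - {i, j}) (\<lambda>_. M). F (z(i := fst p, j := snd p))))"
proof -
  let ?R = "PiM (V - {i, j}) (\<lambda>_. M)"
  let ?Q = "(M \<Otimes>\<^sub>M M) \<Otimes>\<^sub>M ?R"
  let ?g = "\<lambda>((x, y), z). z(i := x, j := y)"
  let ?H = "\<lambda>s. f (fst s) * F (?g s)"
  interpret MM: pair_prob_space M M ..
  interpret R: prob_space ?R by (intro prob_space_PiM prob_space_axioms)
  interpret Q: pair_prob_space "M \<Otimes>\<^sub>M M" ?R ..
  have g[measurable]: "?g \<in> measurable ?Q (PiM V (\<lambda>_. M))"
    using V by (intro measurable_upd_pair) auto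
  note [measurable] = F(1) f(1)
  have [measurable]: "i \<in> V" "j \<in> V" using V by auto
  have "(LINT x|PiM V (\<lambda>_. M). f (x i, x j) * F x) = (LINT s|?Q. f (?g s i, ?g s j) * F (?g s))"
    by (subst PiM_split_pair[OF V, symmetric], rule integral_distr[OF g]) measurable
  also have "\<dots> = (LINT s|?Q. ?H s)"
    using V by (intro Bochner_Integration.integral_cong) auto
  also have "\<dots> = (LINT p|(M \<Otimes>\<^sub>M M). LINT z|?R. ?H (p, z))"
  proof (rule Q.integral_fst'[symmetric], rule Q.P.integrable_const_bound[where B = "D * C"])
    show "AE s in ?Q. norm (?H s) \<le> D * C"
    proof (rule AE_I2)
      fix s assume s: "s \<in> space ?Q"
      then have "fst s \<in> space (M \<Otimes>\<^sub>M M)" by (auto simp: space_pair_measure)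
      then have "\<bar>f (fst s)\<bar> \<le> D" by (rule f(2))
      moreover have "\<bar>F (?g s)\<bar> \<le> C"
        using measurable_space[OF g s] by (rule F(2))
      ultimately show "norm (?H s) \<le> D * C"
        by (simp add: abs_mult mult_mono')
    qed
  qed measurable
  also have "\<dots> = (LINT p|(M \<Otimes>\<^sub>M M). f p * (LINT z|?R. F (z(i := fst p, j := snd p))))"
    by (intro Bochner_Integration.integral_cong) (auto simp: split_beta)
  finally show ?thesis .
qed

section \<open>The variance of an edge sum\<close>

text \<open>Given the common coordinate \<open>x i\<close>, both factors have conditional expectation \<open>d (x i)\<close>, where
  \<open>d\<close> is the degree function of \<open>f\<close>, and they are conditionally independent; so the correlation is
  the integral of \<open>d\<^sup>2\<close>.\<close>

lemma star_correlation_nonneg: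
  fixes f :: "'a \<times> 'a \<Rightarrow> real"
  assumes V: "finite V" "i \<in> V" "j \<in> V" "l \<in> V" "i \<noteq> j" "i \<noteq> l" "j \<noteq> l"
    and f: "f \<in> borel_measurable (M \<Otimes>\<^sub>M M)" "\<And>p. p \<in> space (M \<Otimes>\<^sub>M M) \<Longrightarrow> \<bar>f p\<bar> \<le> D"
  shows "0 \<le> (LINT x|PiM V (\<lambda>_. M). f (x i, x j) * f (x i, x l))"
proof -
  interpret MM: pair_prob_space M M ..
  let ?R = "PiM (V - {i, j}) (\<lambda>_. M)"
  define d where "d x = (LINT y|M. f (x, y))" for x
  note [measurable] = f(1)
  have [measurable]: "i \<in> V" "l \<in> V" using V by auto
  have d_meas[measurable]: "d \<in> borel_measurable M"
    unfolding d_def by measurable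
  have D: "\<bar>d x\<bar> \<le> D" if x: "x \<in> space M" for x
  proof -
    have "integrable M (\<lambda>y. f (x, y))"
      using x f(2) by (intro integrable_const_bound[where B = D] AE_I2) (auto simp: space_pair_measure)
    moreover from this have "integrable M (\<lambda>y. \<bar>f (x, y)\<bar>)" by simp
    ultimately have "\<bar>d x\<bar> \<le> (LINT y|M. D)"
      unfolding d_def using x f(2)
      by (intro order_trans[OF integral_abs_bound] integral_mono) (auto simp: space_pair_measure)
    then show ?thesis by (simp add: prob_space)
  qed
  have "(LINT x|PiM V (\<lambda>_. M). f (x i, x j) * f (x i, x l))
      = (LINT p|(M \<Otimes>\<^sub>M M). f p * (LINT z|?R. f ((z(i := fst p, j := snd p)) i, (z(i := fst p, j := snd p)) l)))"
    using V f(2) by (intro integral_PiM_split_pair[where C = D and D = D] f)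
      (auto simp: space_pair_measure space_PiM PiE_def Pi_def)
  also have "\<dots> = (LINT p|(M \<Otimes>\<^sub>M M). f p * d (fst p))"
  proof (intro Bochner_Integration.integral_cong refl)
    fix p assume "p \<in> space (M \<Otimes>\<^sub>M M)"
    then have p: "fst p \<in> space M" by (auto simp: space_pair_measure)
    have "d (fst p) = (LINT y|distr ?R M (\<lambda>z. z l). f (fst p, y))"
      using V by (subst distr_PiM_component) (auto simp: d_def prob_space_axioms)
    also have "\<dots> = (LINT z|?R. f (fst p, z l))"
      using p V by (intro integral_distr) auto
    finally show "f p * (LINT z|?R. f ((z(i := fst p, j := snd p)) i, (z(i := fst p, j := snd p)) l))
        = f p * d (fst p)"
      using V by simp
  qed
  also have "\<dots> = (LINT x|M. LINT y|M. f (x, y) * d (fst (x, y)))"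
  proof (rule MM.integral_fst'[symmetric], rule MM.P.integrable_const_bound[where B = "D * D"])
    show "AE p in M \<Otimes>\<^sub>M M. norm (f p * d (fst p)) \<le> D * D"
      using f(2) D by (auto intro!: AE_I2 simp: abs_mult space_pair_measure mult_mono')
  qed measurable
  also have "\<dots> = (LINT x|M. (d x)\<^sup>2)"
    by (simp add: d_def power2_eq_square)
  finally show ?thesis by simp
qed

text \<open>The correlation is zero for disjoint pairs, the second moment of \<open>f\<close> for
  equal pairs, and otherwise, by the symmetry of \<open>f\<close>, that of a star with two edges.\<close>

lemma pair_correlation_nonneg:
  fixes f :: "'a \<times> 'a \<Rightarrow> real"
  assumes V: "finite V" "i \<in> V" "j \<in> V" "k \<in> V" "l \<in> V" and ne: "i \<noteq> j" "k \<noteq> l"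
    and f: "f \<in> borel_measurable (M \<Otimes>\<^sub>M M)" "\<And>p. p \<in> space (M \<Otimes>\<^sub>M M) \<Longrightarrow> \<bar>f p\<bar> \<le> D"
    and sym: "\<And>x y. x \<in> space M \<Longrightarrow> y \<in> space M \<Longrightarrow> f (x, y) = f (y, x)"
    and mean: "(LINT p|(M \<Otimes>\<^sub>M M). f p) = 0"
  shows "0 \<le> (LINT x|PiM V (\<lambda>_. M). f (x i, x j) * f (x k, x l))"
proof -
  let ?P = "PiM V (\<lambda>_. M)"
  note [measurable] = f(1)
  have swap: "f (x r, x s) = f (x s, x r)" if "x \<in> space ?P" "r \<in> V" "s \<in> V" for x r s
    using that by (intro sym) (auto simp: space_PiM)
  have swapL: "(LINT x|?P. f (x r, x s) * G x) = (LINT x|?P. f (x s, x r) * G x)"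
    if "r \<in> V" "s \<in> V" for r s G
    using swap that by (intro Bochner_Integration.integral_cong) auto
  have swapR: "(LINT x|?P. G x * f (x r, x s)) = (LINT x|?P. G x * f (x s, x r))"
    if "r \<in> V" "s \<in> V" for r s G
    using swap that by (intro Bochner_Integration.integral_cong) auto
  consider "{i, j} \<inter> {k, l} = {}" | "i = k" "j = l" | "i = l" "j = k"
    | "i = k" "j \<noteq> l" | "i = l" "j \<noteq> k" | "j = k" "i \<noteq> l" | "j = l" "i \<noteq> k" by blast
  then show ?thesis
  proof cases
    case 1
    have [measurable]: "k \<in> V" "l \<in> V" using V by auto
    have "(LINT x|?P. f (x i, x j) * f (x k, x l))
      = (LINT p|(M \<Otimes>\<^sub>M M). f p * (LINT z|PiM (V - {i, j}) (\<lambda>_. M).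
          f ((z(i := fst p, j := snd p)) k, (z(i := fst p, j := snd p)) l)))"
      using V ne f(2) by (intro integral_PiM_split_pair[where C = D and D = D] f)
        (auto simp: space_pair_measure space_PiM PiE_def Pi_def)
    also have "\<dots> = (LINT p|(M \<Otimes>\<^sub>M M). f p * (LINT z|PiM (V - {i, j}) (\<lambda>_. M). f (z k, z l)))"
      using 1 by simp
    also have "(LINT z|PiM (V - {i, j}) (\<lambda>_. M). f (z k, z l)) = 0"
      using 1 V ne f by (subst integral_PiM_pair) (auto simp: mean)
    finally show ?thesis by simp
  next
    case 2 then show ?thesis by simp
  next
    case 3
    then show ?thesis using V by (subst swapL) auto
  next
    case 4
    then show ?thesis using star_correlation_nonneg[of V i j l f D] V ne f by simp
  next
    case 5
    then show ?thesis
      using star_correlation_nonneg[of V i j k f D] V ne f by (subst swapR) auto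
  next
    case 6
    then show ?thesis
      using star_correlation_nonneg[of V j i l f D] V ne f by (subst swapL) auto
  next
    case 7
    then show ?thesis
      using star_correlation_nonneg[of V j i k f D] V ne f by (subst swapL, simp, simp, subst swapR) auto
  qed
qed


text \<open>Expanding the square, the diagonal terms give the left-hand side, and the
  off-diagonal terms are nonnegative.\<close>

lemma sum_square_ge:
  fixes f :: "'a \<times> 'a \<Rightarrow> real" and \<epsilon> :: "'e \<Rightarrow> 'v \<times> 'v"
  assumes V: "finite V" and E: "finite E"
    and \<epsilon>: "\<And>e. e \<in> E \<Longrightarrow> fst (\<epsilon> e) \<in> V \<and> snd (\<epsilon> e) \<in> V \<and> fst (\<epsilon> e) \<noteq> snd (\<epsilon> e)"
    and f: "f \<in> borel_measurable (M \<Otimes>\<^sub>M M)" "\<And>p. p \<in> space (M \<Otimes>\<^sub>M M) \<Longrightarrow> \<bar>f p\<bar> \<le> D"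
    and sym: "\<And>x y. x \<in> space M \<Longrightarrow> y \<in> space M \<Longrightarrow> f (x, y) = f (y, x)"
    and mean: "(LINT p|(M \<Otimes>\<^sub>M M). f p) = 0"
  shows "real (card E) * (LINT p|(M \<Otimes>\<^sub>M M). (f p)\<^sup>2)
    \<le> (LINT x|PiM V (\<lambda>_. M). (\<Sum>e\<in>E. f (map_prod x x (\<epsilon> e)))\<^sup>2)"
proof -
  let ?P = "PiM V (\<lambda>_. M)"
  interpret P: prob_space ?P by (intro prob_space_PiM prob_space_axioms)
  note map_prod = map_prod_eq_Pair
  define c where "c e e' = (LINT x|?P. f (map_prod x x (\<epsilon> e)) * f (map_prod x x (\<epsilon> e')))" for e e'
  have meas: "(\<lambda>x. f (map_prod x x (\<epsilon> e))) \<in> borel_measurable ?P" if "e \<in> E" for e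
    using f(1) \<epsilon>[OF that] by (intro borel_measurable_PiM_edge) auto
  have bound: "\<bar>f (map_prod x x (\<epsilon> e))\<bar> \<le> D" if "e \<in> E" "x \<in> space ?P" for e x
    using \<epsilon>[OF that(1)] that(2) unfolding map_prod
    by (intro f(2)) (auto simp: space_pair_measure space_PiM)
  have int: "integrable ?P (\<lambda>x. f (map_prod x x (\<epsilon> e)) * f (map_prod x x (\<epsilon> e')))"
    if "e \<in> E" "e' \<in> E" for e e'
    using that meas bound
    by (intro P.integrable_const_bound[where B = "D * D"] AE_I2) (auto simp: abs_mult intro!: mult_mono')
  have "(LINT x|?P. (\<Sum>e\<in>E. f (map_prod x x (\<epsilon> e)))\<^sup>2) = (\<Sum>e\<in>E. \<Sum>e'\<in>E. c e e')"
    using int by (simp add: power2_eq_square sum_product c_def)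
  also have "\<dots> \<ge> (\<Sum>e\<in>E. c e e)"
  proof (intro sum_mono)
    fix e assume e: "e \<in> E"
    have "0 \<le> c e e'" if "e' \<in> E" for e'
      using pair_correlation_nonneg[OF V _ _ _ _ _ _ f sym mean] \<epsilon>[OF e] \<epsilon>[OF that]
      unfolding c_def map_prod by blast
    then show "c e e \<le> (\<Sum>e'\<in>E. c e e')" using e E by (intro member_le_sum) auto
  qed
  also have "(\<Sum>e\<in>E. c e e) = (\<Sum>e\<in>E. LINT p|(M \<Otimes>\<^sub>M M). (f p)\<^sup>2)"
  proof (intro sum.cong refl)
    fix e assume "e \<in> E"
    then show "c e e = (LINT p|(M \<Otimes>\<^sub>M M). (f p)\<^sup>2)"
      unfolding c_def map_prod power2_eq_square
      using V \<epsilon> f(1) integral_PiM_pair[of V "fst (\<epsilon> e)" "snd (\<epsilon> e)" "\<lambda>p. f p * f p"] by auto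
  qed
  finally show ?thesis by simp
qed

section \<open>Comparing the exponentially weighted mean with the variance\<close>

text \<open>The pointwise inequality \<open>(s - c) (exp s - exp c) \<ge> exp (- L) (s - c)\<^sup>2\<close> for \<open>s\<close> and \<open>c\<close> above
  \<open>- L\<close> is integrated over \<open>s = S x\<close>; the term with \<open>exp c\<close> vanishes because \<open>c\<close> is the mean.\<close>

lemma exp_tilt_ge_variance:
  fixes S :: "'a \<Rightarrow> real"
  assumes S: "S \<in> borel_measurable M" "\<And>x. x \<in> space M \<Longrightarrow> - L \<le> S x \<and> S x \<le> 0"
    and c: "(LINT x|M. S x) = c"
  shows "exp (- L) * (LINT x|M. (S x - c)\<^sup>2) \<le> (LINT x|M. (S x - c) * exp (S x))"
proof -
  note [measurable] = S(1)
  have "\<bar>S x\<bar> \<le> L" if "x \<in> space M" for x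
    using S(2)[OF that] by linarith
  then have intS: "integrable M S"
    by (intro integrable_const_bound[where B = L] AE_I2) auto
  have "- L \<le> c"
  proof -
    have "(LINT x|M. - L) \<le> (LINT x|M. S x)"
      using intS S(2) by (intro integral_mono) auto
    then show ?thesis using c by (simp add: prob_space)
  qed
  have "c \<le> 0"
    using Bochner_Integration.integral_nonneg[of M "\<lambda>x. - S x"] S(2) c by simp
  have dev: "\<bar>S x - c\<bar> \<le> L" if "x \<in> space M" for x
    using S(2)[OF that] \<open>- L \<le> c\<close> \<open>c \<le> 0\<close> by auto
  have int: "integrable M (\<lambda>x. (S x - c) * exp (S x))"
  proof (rule integrable_const_bound[where B = "L * 1"])
    show "AE x in M. norm ((S x - c) * exp (S x)) \<le> L * 1"
    proof (rule AE_I2)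
      fix x assume "x \<in> space M"
      from dev[OF this] S(2)[OF this] show "norm ((S x - c) * exp (S x)) \<le> L * 1"
        unfolding real_norm_def abs_mult by (intro mult_mono') simp_all
    qed
  qed measurable
  have int2: "integrable M (\<lambda>x. (S x - c)\<^sup>2)"
  proof (rule integrable_const_bound[where B = "L\<^sup>2"])
    show "AE x in M. norm ((S x - c)\<^sup>2) \<le> L\<^sup>2"
      using power_mono[OF dev, of _ 2] by (intro AE_I2) simp
  qed measurable
  have int1: "integrable M (\<lambda>x. (S x - c) * exp c)"
    using intS by simp
  have gap: "exp (- L) * (s - r)\<^sup>2 \<le> (s - r) * (exp s - exp r)" if "- L \<le> r" "r \<le> s" for r s :: real
  proof -
    have "exp (- L) * (s - r) \<le> exp r * (s - r)"
      using that by (intro mult_right_mono) auto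
    also have "\<dots> \<le> exp r * (exp (s - r) - 1)"
      using exp_ge_add_one_self[of "s - r"] by (intro mult_left_mono, linarith) simp
    also have "\<dots> = exp s - exp r"
      by (simp add: algebra_simps flip: exp_add)
    finally show ?thesis
      using mult_left_mono[of "exp (- L) * (s - r)" "exp s - exp r" "s - r"] that
      by (simp add: power2_eq_square mult_ac)
  qed
  have "exp (- L) * (LINT x|M. (S x - c)\<^sup>2) = (LINT x|M. exp (- L) * (S x - c)\<^sup>2)"
    by simp
  also have "\<dots> \<le> (LINT x|M. (S x - c) * exp (S x) - (S x - c) * exp c)"
  proof (intro integral_mono Bochner_Integration.integrable_diff int int1 integrable_mult_right int2)
    fix x assume x: "x \<in> space M"
    show "exp (- L) * (S x - c)\<^sup>2 \<le> (S x - c) * exp (S x) - (S x - c) * exp c"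
    proof (cases "c \<le> S x")
      case True
      then show ?thesis using gap[of c "S x"] \<open>- L \<le> c\<close> by (simp add: algebra_simps)
    next
      case False
      then show ?thesis using gap[of "S x" c] S(2)[OF x]
        by (simp add: algebra_simps power2_commute)
    qed
  qed
  also have "\<dots> = (LINT x|M. (S x - c) * exp (S x))"
    using int intS c by (simp add: prob_space)
  finally show ?thesis .
qed


section \<open>The bound for a measurable kernel on a probability space\<close>

text \<open>Here \<open>r e / t\<close> is the normalized marginal of \<open>exp S\<close> on the ends of \<open>e\<close>. The
  integral of \<open>(S - m u) exp S\<close> lies between \<open>exp (- m M)\<close> times the variance of \<open>S\<close> and \<open>M\<close>
  times the sum of the marginal errors.\<close>

lemma log_variance_le_marginals:
  fixes w :: "'a \<times> 'a \<Rightarrow> real" and \<epsilon> :: "'e \<Rightarrow> 'v \<times> 'v"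
  assumes V: "finite V" and E: "finite E"
    and \<epsilon>: "\<And>e. e \<in> E \<Longrightarrow> fst (\<epsilon> e) \<in> V \<and> snd (\<epsilon> e) \<in> V \<and> fst (\<epsilon> e) \<noteq> snd (\<epsilon> e)"
    and w: "w \<in> borel_measurable (M \<Otimes>\<^sub>M M)" "\<And>p. a \<le> w p \<and> w p \<le> 1" "0 < a"
    and sym: "\<And>x y. w (x, y) = w (y, x)"
  defines "u \<equiv> (LINT p|(M \<Otimes>\<^sub>M M). ln (w p))"
    and "G \<equiv> \<lambda>x. \<Prod>e\<in>E. w (map_prod x x (\<epsilon> e))"
  defines "t \<equiv> (LINT x|PiM V (\<lambda>_. M). G x)"
    and "r \<equiv> \<lambda>e p. LINT z|PiM (V - {fst (\<epsilon> e), snd (\<epsilon> e)}) (\<lambda>_. M).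
      G (z(fst (\<epsilon> e) := fst p, snd (\<epsilon> e) := snd p))"
  shows "real (card E) * (LINT p|(M \<Otimes>\<^sub>M M). (ln (w p) - u)\<^sup>2)
    \<le> exp (real (card E) * ln (1 / a)) * ln (1 / a)
        * (\<Sum>e\<in>E. LINT p|(M \<Otimes>\<^sub>M M). \<bar>r e p / t - 1\<bar>)"
proof -
  let ?P = "PiM V (\<lambda>_. M)" and ?MM = "M \<Otimes>\<^sub>M M"
  define K where "K = ln (1 / a)"
  define L where "L = real (card E) * K"
  define h where "h p = ln (w p) - u" for p
  define S where "S x = (\<Sum>e\<in>E. ln (w (map_prod x x (\<epsilon> e))))" for x :: "'v \<Rightarrow> 'a"
  interpret MM: pair_prob_space M M ..
  interpret P: prob_space ?P by (intro prob_space_PiM prob_space_axioms)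
  note [measurable] = w(1)
  have h_meas[measurable]: "h \<in> borel_measurable ?MM" unfolding h_def by measurable
  note map_prod = map_prod_eq_Pair
  have wpos: "0 < w p" for p using w(2)[of p] w(3) by linarith
  have "a \<le> 1" using w(2)[of undefined] by linarith
  then have K0: "0 \<le> K" using w(3) by (simp add: K_def)
  have lnw: "- K \<le> ln (w p)" "ln (w p) \<le> 0" for p
    using w(2)[of p] w(3) wpos[of p] by (auto simp: K_def ln_div)
  have lnw_abs: "\<bar>ln (w p)\<bar> \<le> K" for p
    using lnw[of p] by linarith
  have int_lnw: "integrable ?MM (\<lambda>p. ln (w p))"
    using lnw_abs by (intro MM.P.integrable_const_bound[where B = K] AE_I2) auto
  have u: "- K \<le> u" "u \<le> 0"
  proof -
    have "(LINT p|?MM. - K) \<le> u"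
      unfolding u_def using int_lnw lnw by (intro integral_mono) auto
    then show "- K \<le> u" by (simp add: MM.P.prob_space)
    have "0 \<le> (LINT p|?MM. - ln (w p))"
      using lnw by (intro Bochner_Integration.integral_nonneg) auto
    then show "u \<le> 0" by (simp add: u_def)
  qed
  have h_bound: "\<bar>h p\<bar> \<le> K" for p
    using lnw[of p] u by (auto simp: h_def)
  have int_h: "integrable ?MM h"
    using h_bound by (intro MM.P.integrable_const_bound[where B = K] AE_I2) auto
  have h_mean: "(LINT p|?MM. h p) = 0"
    using int_lnw by (simp add: h_def u_def MM.P.prob_space)
  have factor_meas: "(\<lambda>x. w (map_prod x x (\<epsilon> e))) \<in> borel_measurable ?P" if "e \<in> E" for e
    using w(1) \<epsilon>[OF that] by (intro borel_measurable_PiM_edge) auto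
  have G_meas[measurable]: "G \<in> borel_measurable ?P"
    unfolding G_def using factor_meas by (intro borel_measurable_prod) auto
  have S_meas: "S \<in> borel_measurable ?P"
    unfolding S_def using factor_meas by (intro borel_measurable_sum borel_measurable_ln) auto
  have G_S: "G x = exp (S x)" for x
    using wpos E by (simp add: G_def S_def exp_sum)
  have S_bound: "- L \<le> S x" "S x \<le> 0" for x
  proof -
    have "(\<Sum>e\<in>E. - K) \<le> S x" unfolding S_def using lnw by (intro sum_mono)
    then show "- L \<le> S x" by (simp add: L_def)
    show "S x \<le> 0" unfolding S_def using lnw by (intro sum_nonpos) auto
  qed
  have G_bound: "0 < G x" "G x \<le> 1" "exp (- L) \<le> G x" for x
    using S_bound[of x] by (auto simp: G_S)
  have int_G: "integrable ?P G"
    using G_bound by (intro P.integrable_const_bound[where B = 1] AE_I2) (auto simp: less_imp_le)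
  have t: "0 < t" "t \<le> 1"
  proof -
    have "(LINT x|?P. exp (- L)) \<le> t"
      unfolding t_def using int_G G_bound by (intro integral_mono) auto
    then show "0 < t" by (simp add: P.prob_space) (meson exp_gt_zero less_le_trans)
    have "t \<le> (LINT x|?P. 1)"
      unfolding t_def using int_G G_bound by (intro integral_mono) auto
    then show "t \<le> 1" by (simp add: P.prob_space)
  qed
  have S_mean: "(LINT x|?P. S x) = real (card E) * u"
  proof -
    have int: "integrable ?P (\<lambda>x. ln (w (map_prod x x (\<epsilon> e))))" if "e \<in> E" for e
      using lnw_abs factor_meas[OF that]
      by (intro P.integrable_const_bound[where B = K] AE_I2) auto
    have "(LINT x|?P. ln (w (map_prod x x (\<epsilon> e)))) = u" if "e \<in> E" for e
      unfolding map_prod u_def using V \<epsilon>[OF that] by (intro integral_PiM_pair) auto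
    then show ?thesis using int by (simp add: S_def)
  qed
  have S_dev: "S x - real (card E) * u = (\<Sum>e\<in>E. h (map_prod x x (\<epsilon> e)))" for x
    by (simp add: S_def h_def sum_subtractf)
  have r_meas[measurable]: "r e \<in> borel_measurable ?MM" if "e \<in> E" for e
    unfolding r_def using \<epsilon>[OF that] G_meas by (intro borel_measurable_rooted_integral) auto
  have r_bound: "\<bar>r e p\<bar> \<le> 1" for e p
  proof -
    interpret R: prob_space "PiM (V - {fst (\<epsilon> e), snd (\<epsilon> e)}) (\<lambda>_. M)"
      by (intro prob_space_PiM prob_space_axioms)
    have "0 \<le> r e p" unfolding r_def using G_bound by (intro Bochner_Integration.integral_nonneg) (auto simp: less_imp_le)
    moreover have "r e p \<le> 1"
    \<comment> \<open>For arguments outside \<open>E\<close> or outside the space the integrand may fail to be integrable;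
        the integral is then zero by convention.\<close>
    proof (cases "integrable (PiM (V - {fst (\<epsilon> e), snd (\<epsilon> e)}) (\<lambda>_. M))
        (\<lambda>z. G (z(fst (\<epsilon> e) := fst p, snd (\<epsilon> e) := snd p)))")
      case True
      then show ?thesis
        unfolding r_def using G_bound by (intro R.integral_le_const) auto
    next
      case False
      then show ?thesis by (simp add: r_def not_integrable_integral_eq)
    qed
    ultimately show ?thesis by simp
  qed
  have edge: "(LINT x|?P. h (map_prod x x (\<epsilon> e)) * G x) \<le> K * (LINT p|?MM. \<bar>r e p / t - 1\<bar>)"
    if "e \<in> E" for e
  proof -
    note [measurable] = r_meas[OF that]
    have int_hr: "integrable ?MM (\<lambda>p. h p * r e p)"
      using h_bound r_bound by (intro MM.P.integrable_const_bound[where B = "K * 1"] AE_I2)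
        (auto simp: abs_mult simp del: mult_1_right intro!: mult_mono')
    have int_r: "integrable ?MM (r e)"
      using r_bound by (intro MM.P.integrable_const_bound[where B = 1] AE_I2) auto
    have int_q: "integrable ?MM (\<lambda>p. \<bar>r e p / t - 1\<bar>)"
      using int_r by simp
    have "(LINT x|?P. h (map_prod x x (\<epsilon> e)) * G x) = (LINT p|?MM. h p * r e p)"
      unfolding map_prod r_def using V \<epsilon>[OF that] h_bound G_bound
      by (intro integral_PiM_split_pair[where C = 1 and D = K]) (auto simp: less_imp_le abs_le_iff)
    \<comment> \<open>As \<open>h\<close> has mean zero, the constant \<open>t\<close> may be subtracted from \<open>r e\<close>.\<close>
    also have "\<dots> = (LINT p|?MM. h p * r e p - h p * t)"
      using int_hr int_h h_mean by simp
    also have "\<dots> \<le> (LINT p|?MM. K * \<bar>r e p / t - 1\<bar>)"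
    proof (intro integral_mono Bochner_Integration.integrable_diff int_hr integrable_mult_left int_h
        integrable_mult_right int_q)
      fix p
      have "h p * r e p - h p * t = t * (h p * (r e p / t - 1))"
        using t by (simp add: field_simps)
      also have "\<dots> \<le> t * (K * \<bar>r e p / t - 1\<bar>)"
      proof (intro mult_left_mono)
        have "h p * (r e p / t - 1) \<le> \<bar>h p\<bar> * \<bar>r e p / t - 1\<bar>"
          by (simp flip: abs_mult)
        then show "h p * (r e p / t - 1) \<le> K * \<bar>r e p / t - 1\<bar>"
          using h_bound[of p] by (meson abs_ge_zero mult_right_mono order_trans)
      qed (use t in auto)
      also have "\<dots> \<le> 1 * (K * \<bar>r e p / t - 1\<bar>)"
        using t K0 by (intro mult_right_mono) auto
      finally show "h p * r e p - h p * t \<le> K * \<bar>r e p / t - 1\<bar>" by simp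
    qed
    finally show ?thesis by simp
  qed
  have "real (card E) * (LINT p|?MM. (h p)\<^sup>2) \<le> (LINT x|?P. (S x - real (card E) * u)\<^sup>2)"
    unfolding S_dev using h_bound h_mean sym
    by (intro sum_square_ge[where D = K] V E \<epsilon>) (auto simp: h_def)
  also have "\<dots> = exp L * (exp (- L) * (LINT x|?P. (S x - real (card E) * u)\<^sup>2))"
    by (simp flip: exp_add mult.assoc)
  also have "\<dots> \<le> exp L * (LINT x|?P. (S x - real (card E) * u) * exp (S x))"
    using S_meas S_bound S_mean by (intro mult_left_mono P.exp_tilt_ge_variance) auto
  also have "(LINT x|?P. (S x - real (card E) * u) * exp (S x))
      = (\<Sum>e\<in>E. LINT x|?P. h (map_prod x x (\<epsilon> e)) * G x)"
  proof -
    have "integrable ?P (\<lambda>x. h (map_prod x x (\<epsilon> e)) * G x)" if "e \<in> E" for e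
    proof -
      have "(\<lambda>x. h (map_prod x x (\<epsilon> e)) * G x) \<in> borel_measurable ?P"
        using \<epsilon>[OF that] h_meas G_meas
        by (intro borel_measurable_times borel_measurable_PiM_edge) auto
      moreover have "norm (h (map_prod x x (\<epsilon> e)) * G x) \<le> K * 1" for x
        using G_bound[of x] unfolding real_norm_def abs_mult
        by (intro mult_mono' h_bound) simp_all
      ultimately show ?thesis
        by (intro P.integrable_const_bound[where B = "K * 1"] AE_I2)
    qed
    then show ?thesis by (simp add: S_dev sum_distrib_right flip: G_S)
  qed
  also have "exp L * \<dots> \<le> exp L * (\<Sum>e\<in>E. K * (LINT p|?MM. \<bar>r e p / t - 1\<bar>))"
    using edge by (intro mult_left_mono sum_mono) auto
  finally show ?thesis
    by (simp add: h_def L_def K_def sum_distrib_left mult_ac)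
qed

end

section \<open>Null sets in a finite power\<close>

context prob_space
begin

lemma AE_PiM_pair:
  assumes "finite V" "i \<in> V" "j \<in> V" "i \<noteq> j" "AE p in M \<Otimes>\<^sub>M M. Q p"
  shows "AE x in PiM V (\<lambda>_. M). Q (x i, x j)"
proof (rule AE_distrD[where P = Q and f = "\<lambda>x. (x i, x j)"])
  show "(\<lambda>x. (x i, x j)) \<in> measurable (PiM V (\<lambda>_. M)) (M \<Otimes>\<^sub>M M)"
    using assms by auto
  show "AE p in distr (PiM V (\<lambda>_. M)) (M \<Otimes>\<^sub>M M) (\<lambda>x. (x i, x j)). Q p"
    unfolding distr_PiM_pair[OF assms(1-4)] by (rule assms(5))
qed

text \<open>Almost every slice of a null set of the cube, taken at fixed values of \<open>x i\<close> and \<open>x j\<close>, is a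
  null set. This is what makes edge-rooted densities insensitive to changing the kernel on a null
  set.\<close>

lemma AE_PiM_split_pair:
  assumes V: "finite V" "i \<in> V" "j \<in> V" "i \<noteq> j" and Q: "AE x in PiM V (\<lambda>_. M). Q x"
  shows "AE p in M \<Otimes>\<^sub>M M. AE z in PiM (V - {i, j}) (\<lambda>_. M). Q (z(i := fst p, j := snd p))"
proof -
  let ?R = "PiM (V - {i, j}) (\<lambda>_. M)"
  interpret MM: pair_prob_space M M ..
  interpret R: prob_space ?R by (intro prob_space_PiM prob_space_axioms)
  interpret Q: pair_prob_space "M \<Otimes>\<^sub>M M" ?R ..
  have "AE s in (M \<Otimes>\<^sub>M M) \<Otimes>\<^sub>M ?R. Q ((\<lambda>((x, y), z). z(i := x, j := y)) s)"
    by (rule AE_distrD[OF measurable_upd_pair[OF V(2,3)]]) (unfold PiM_split_pair[OF V], rule Q)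
  from Q.AE_pair[OF this] show ?thesis by (simp add: split_beta)
qed

end

section \<open>The unit square as a product of probability spaces\<close>

text \<open>The identity map is measurable in both directions.\<close>

lemma sets_pair_restrict_space:
  assumes X: "X \<in> sets M" and Y: "Y \<in> sets N"
  shows "sets (restrict_space M X \<Otimes>\<^sub>M restrict_space N Y)
    = sets (restrict_space (M \<Otimes>\<^sub>M N) (X \<times> Y))"
    (is "sets ?A = sets ?B")
proof
  have space: "space ?A = X \<times> Y" "space ?B = X \<times> Y"
    using sets.sets_into_space[OF X] sets.sets_into_space[OF Y]
    by (auto simp: space_pair_measure space_restrict_space)
  have "fst \<in> space ?B \<rightarrow> X" "snd \<in> space ?B \<rightarrow> Y"
    unfolding space by auto
  moreover have "fst \<in> measurable ?B M" "snd \<in> measurable ?B N"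
    by (auto intro: measurable_restrict_space1)
  ultimately have "fst \<in> measurable ?B (restrict_space M X)" "snd \<in> measurable ?B (restrict_space N Y)"
    by (auto intro: measurable_restrict_space2)
  from measurable_Pair[OF this] have "(\<lambda>z. z) \<in> measurable ?B ?A" by simp
  from measurable_sets[OF this] show "sets ?A \<subseteq> sets ?B"
    using sets.sets_into_space[of _ ?A] by (auto simp: space Int_absorb2)
  have "fst \<in> measurable ?A M" "snd \<in> measurable ?A N"
    by (rule measurable_compose[OF measurable_fst], simp add: measurable_restrict_space1)
      (rule measurable_compose[OF measurable_snd], simp add: measurable_restrict_space1)
  from measurable_Pair[OF this] have "(\<lambda>z. z) \<in> measurable ?A (M \<Otimes>\<^sub>M N)" by simp
  from measurable_sets[OF this] show "sets ?B \<subseteq> sets ?A"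
    by (auto simp: space sets_restrict_space Int_commute)
qed

abbreviation unit_interval :: "real measure" where
  "unit_interval \<equiv> restrict_space lborel {0..1}"

lemma prob_space_unit_interval: "prob_space unit_interval"
  by (rule prob_spaceI) (simp add: space_restrict_space emeasure_restrict_space)

lemma unit_interval_pair: "unit_interval \<Otimes>\<^sub>M unit_interval = restrict_space lborel unit_square"
proof (rule pair_measure_eqI)
  interpret prob_space unit_interval by (rule prob_space_unit_interval)
  show "sigma_finite_measure unit_interval" "sigma_finite_measure unit_interval" by unfold_locales
  have "sets (unit_interval \<Otimes>\<^sub>M unit_interval)
      = sets (restrict_space (lborel \<Otimes>\<^sub>M lborel) unit_square)"
    by (rule sets_pair_restrict_space) auto
  then show "sets (unit_interval \<Otimes>\<^sub>M unit_interval) = sets (restrict_space lborel unit_square)"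
    by (simp add: lborel_prod)
next
  fix A B :: "real set" assume "A \<in> sets unit_interval" "B \<in> sets unit_interval"
  then have "A \<subseteq> {0..1}" "A \<in> sets lborel" "B \<subseteq> {0..1}" "B \<in> sets lborel"
    by (auto simp: sets_restrict_space_iff)
  then show "emeasure unit_interval A * emeasure unit_interval B
      = emeasure (restrict_space lborel unit_square) (A \<times> B)"
    using lborel.emeasure_pair_measure_Times[of A lborel B]
    by (subst (1 2 3) emeasure_restrict_space) (auto simp: lborel_prod borel_closed closed_Times)
qed

lemma AE_lebesgue_on_unit_square:
  "(AE z in lebesgue_on unit_square. Q z) \<longleftrightarrow> (AE z in unit_interval \<Otimes>\<^sub>M unit_interval. Q z)"
  unfolding unit_interval_pair
  by (simp add: AE_restrict_space_iff AE_completion_iff borel_closed closed_Times)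

lemma integral_lebesgue_on_unit_square:
  fixes f g :: "real \<times> real \<Rightarrow> real"
  assumes g: "g \<in> borel_measurable (unit_interval \<Otimes>\<^sub>M unit_interval)"
    and eq: "AE z in unit_interval \<Otimes>\<^sub>M unit_interval. f z = g z"
  shows "(LINT z|lebesgue_on unit_square. f z) = (LINT z|(unit_interval \<Otimes>\<^sub>M unit_interval). g z)"
proof -
  have S: "unit_square \<in> sets lborel" by (simp add: borel_closed closed_Times)
  then have S': "unit_square \<in> sets (completion lborel)" by (rule sets_completionI_sets)
  have "(LINT z|lebesgue_on unit_square. f z)
      = (LINT z|completion lborel. indicator unit_square z *\<^sub>R f z)"
    using S' by (subst integral_restrict_space) auto
  also have "\<dots> = (LINT z|lborel. indicator unit_square z *\<^sub>R g z)"
  proof (rule integral_completion_AE_cong)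
    show "(\<lambda>z. indicator unit_square z *\<^sub>R g z) \<in> borel_measurable lborel"
      using g S unfolding unit_interval_pair by (subst (asm) borel_measurable_restrict_space_iff) auto
    have "AE z in lborel. z \<in> unit_square \<longrightarrow> f z = g z"
      using eq S unfolding unit_interval_pair by (subst (asm) AE_restrict_space_iff) auto
    then show "AE z in lborel. indicator unit_square z *\<^sub>R f z = indicator unit_square z *\<^sub>R g z"
      by eventually_elim (auto simp: indicator_def)
  qed
  also have "\<dots> = (LINT z|(unit_interval \<Otimes>\<^sub>M unit_interval). g z)"
    using S unfolding unit_interval_pair by (subst integral_restrict_space) auto
  finally show ?thesis .
qed

section \<open>A Borel representative of a graphon\<close>

text \<open>A Borel function that agrees with \<open>W\<close> almost everywhere need neither be symmetric nor stay
  within the bounds. Truncating its values gives the bounds everywhere, and reflecting its values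
  on the upper triangle at the diagonal gives symmetry; this changes it only on a null set, as the
  reflection preserves the measure.\<close>

lemma graphon_borel_representative:
  assumes W: "graphon W" and a: "a \<le> 1"
    and bounds: "AE z in lebesgue_on unit_square. a \<le> W z \<and> W z \<le> 1"
  obtains w where "w \<in> borel_measurable (unit_interval \<Otimes>\<^sub>M unit_interval)"
    and "\<And>z. a \<le> w z \<and> w z \<le> 1" and "\<And>x y. w (x, y) = w (y, x)"
    and "AE z in unit_interval \<Otimes>\<^sub>M unit_interval. W z = w z"
proof -
  let ?M = "unit_interval \<Otimes>\<^sub>M unit_interval"
  interpret prob_space unit_interval by (rule prob_space_unit_interval)
  interpret MM: pair_prob_space unit_interval unit_interval ..
  have S: "unit_square \<in> sets lborel" by (simp add: borel_closed closed_Times)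
  then have S': "unit_square \<in> sets (completion lborel)" by (rule sets_completionI_sets)
  have "(\<lambda>z. indicator unit_square z *\<^sub>R W z) \<in> borel_measurable (completion lborel)"
    using W S' unfolding graphon_def by (subst (asm) borel_measurable_restrict_space_iff) auto
  then obtain g where g: "g \<in> borel_measurable lborel"
    and eq: "AE z in lborel. indicator unit_square z *\<^sub>R W z = g z"
    using completion_ex_borel_measurable_real by blast
  have [measurable]: "g \<in> borel_measurable borel" using g by simp
  from eq have "AE z in lborel. z \<in> unit_square \<longrightarrow> W z = g z"
    by eventually_elim (auto simp: indicator_def split: if_splits)
  then have "AE z in ?M. W z = g z"
    using S unfolding unit_interval_pair by (subst AE_restrict_space_iff) auto
  moreover have "AE z in ?M. a \<le> W z \<and> W z \<le> 1"
    using bounds by (simp only: AE_lebesgue_on_unit_square)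
  ultimately have good: "AE z in ?M. a \<le> W z \<and> W z \<le> 1 \<and> W z = g z"
    by eventually_elim simp
  have "AE z in ?M. (\<lambda>z. a \<le> W z \<and> W z \<le> 1 \<and> W z = g z) ((\<lambda>(x, y). (y, x)) z)"
    using good by (intro AE_distrD[OF measurable_pair_swap'])
      (simp only: MM.distr_pair_swap[symmetric])
  note good' = this[unfolded split_beta]
  define c where "c z = max a (min 1 (g z))" for z
  define w where "w z = (if fst z \<le> snd z then c z else c (snd z, fst z))" for z
  show ?thesis
  proof
    have [measurable]: "c \<in> borel_measurable borel" unfolding c_def by measurable
    then have [measurable]: "c \<in> borel_measurable (borel \<Otimes>\<^sub>M borel)" by (simp add: borel_prod)
    have "w \<in> borel_measurable (borel \<Otimes>\<^sub>M borel)"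
      unfolding w_def by measurable
    then have "w \<in> borel_measurable lborel" by (simp add: borel_prod)
    then show "w \<in> borel_measurable ?M"
      unfolding unit_interval_pair by (rule measurable_restrict_space1)
    show "a \<le> w z \<and> w z \<le> 1" for z using a by (auto simp: w_def c_def)
    show "w (x, y) = w (y, x)" for x y by (auto simp: w_def)
    have "AE z in ?M. z \<in> space ?M" by simp
    with good good' show "AE z in ?M. W z = w z"
    proof eventually_elim
      case (elim z)
      have "W z = W (snd z, fst z)"
        using W elim(3) by (cases z) (auto simp: graphon_def space_pair_measure space_restrict_space)
      then show ?case using elim(1,2) by (auto simp: w_def c_def)
    qed
  qed
qed


section \<open>The bound for graphons\<close>

lemma abs_exp_diff_le:
  fixes r s :: real
  assumes "r \<le> 0" "s \<le> 0"
  shows "\<bar>exp r - exp s\<bar> \<le> \<bar>r - s\<bar>"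
proof -
  have le: "exp y - exp x \<le> y - x" if "x \<le> y" "y \<le> 0" for x y :: real
  proof -
    have "exp y - exp x = exp y * (1 - exp (x - y))"
      by (simp add: algebra_simps flip: exp_add)
    also have "\<dots> \<le> 1 * (y - x)"
    proof (rule mult_mono)
      show "1 - exp (x - y) \<le> y - x" using exp_ge_add_one_self[of "x - y"] by linarith
    qed (use that in auto)
    finally show ?thesis by simp
  qed
  show ?thesis
  proof (cases "r \<le> s")
    case True
    then show ?thesis using le[of r s] assms by simp
  next
    case False
    then show ?thesis using le[of s r] assms by simp
  qed
qed

theorem theorem3p2:
  fixes V :: "'v set" and E :: "'v set set" and W :: "real \<times> real \<Rightarrow> real"
    and m :: nat and a M u p :: real
  assumes "simple_graph V E" and "m = card E" and "m \<ge> 1"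
    and "graphon W"
    and "0 < a" and "a \<le> 1"
    and "AE z in lebesgue_on unit_square. a \<le> W z \<and> W z \<le> 1"
    and "M = ln (1 / a)"
    and "u = (LINT z|lebesgue_on unit_square. ln (W z))"
    and "p = exp u"
  shows "(L2_norm (\<lambda>z. ln (W z) - u))\<^sup>2
           \<le> 1 / real m * (2 * exp (real m * M) + (real m)\<^sup>2 * M\<^sup>2) * M * marginal_error V E W
       \<and> max ((L1_norm (\<lambda>z. W z - p))\<^sup>2) ((L2_norm (\<lambda>z. W z - p))\<^sup>2)
           \<le> 1 / real m * (2 * exp (real m * M) + (real m)\<^sup>2 * M\<^sup>2) * M * marginal_error V E W"
proof -
  let ?I = "unit_interval"
  let ?S = "?I \<Otimes>\<^sub>M ?I"
  interpret I: prob_space ?I by (rule prob_space_unit_interval)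
  interpret S: pair_prob_space ?I ?I ..
  obtain w where w: "w \<in> borel_measurable ?S" "\<And>z. a \<le> w z \<and> w z \<le> 1"
    and sym: "\<And>x y. w (x, y) = w (y, x)" and eq: "AE z in ?S. W z = w z"
    using graphon_borel_representative[OF assms(4,6,7)] by blast
  note [measurable] = w(1)
  have wpos: "0 < w z" for z using w(2)[of z] assms(5) by linarith
  have V: "finite V" and E_V: "\<And>e. e \<in> E \<Longrightarrow> e \<subseteq> V \<and> card e = 2"
    using assms(1) by (auto simp: simple_graph_def)
  have E: "finite E" using assms(2,3) by (metis card.infinite not_one_le_zero)
  have ends: "fst (ends e) \<in> V \<and> snd (ends e) \<in> V \<and> fst (ends e) \<noteq> snd (ends e)" if "e \<in> E" for e
    using ends_eq[of e "fst (ends e)" "snd (ends e)"] E_V[OF that] by auto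
  have u: "u = (LINT z|?S. ln (w z))"
    unfolding assms(9) using eq by (intro integral_lebesgue_on_unit_square) auto
  have L2: "(L2_norm (\<lambda>z. \<phi> (W z)))\<^sup>2 = (LINT z|?S. (\<phi> (w z))\<^sup>2)"
    if [measurable]: "\<phi> \<in> borel_measurable borel" for \<phi>
  proof -
    have "(LINT z|lebesgue_on unit_square. (\<phi> (W z))\<^sup>2) = (LINT z|?S. (\<phi> (w z))\<^sup>2)"
      using eq by (intro integral_lebesgue_on_unit_square) auto
    then show ?thesis by (simp add: L2_norm_def)
  qed
  define G where "G x = (\<Prod>e\<in>E. w (map_prod x x (ends e)))" for x
  define t where "t = (LINT x|PiM V (\<lambda>_. ?I). G x)"
  define r where "r e q = (LINT z|PiM (V - {fst (ends e), snd (ends e)}) (\<lambda>_. ?I).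
      G (z(fst (ends e) := fst q, snd (ends e) := snd q)))" for e q
  note map_prod = map_prod_eq_Pair
  have G_meas: "G \<in> borel_measurable (PiM V (\<lambda>_. ?I))"
    unfolding G_def
    using w(1) ends by (intro borel_measurable_prod I.borel_measurable_PiM_edge) auto
  have "AE x in PiM V (\<lambda>_. ?I). \<forall>e\<in>E. W (map_prod x x (ends e)) = w (map_prod x x (ends e))"
    unfolding map_prod using V E ends eq
    by (intro AE_finite_allI I.AE_PiM_pair[where Q = "\<lambda>z. W z = w z"]) auto
  then have G_eq: "AE x in PiM V (\<lambda>_. ?I). edge_product E W x = G x"
    by eventually_elim (simp add: edge_product_def G_def map_prod split_beta)
  have hom: "hom_density V E W = t"
    unfolding hom_density_def cube_measure_def t_def
    by (rule integral_completion_AE_cong[OF G_meas G_eq])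
  \<comment> \<open>Only for almost every \<open>q\<close> is the slice at \<open>q\<close> of the exceptional null set of the cube itself
      a null set.\<close>
  have rooted: "AE q in ?S. edge_rooted_density V E W (ends e) q = r e q" if "e \<in> E" for e
  proof -
    have "AE q in ?S. q \<in> space ?S" by simp
    moreover have "AE q in ?S. AE z in PiM (V - {fst (ends e), snd (ends e)}) (\<lambda>_. ?I).
        edge_product E W (z(fst (ends e) := fst q, snd (ends e) := snd q))
        = G (z(fst (ends e) := fst q, snd (ends e) := snd q))"
      using V ends[OF that] G_eq by (intro I.AE_PiM_split_pair) auto
    ultimately show ?thesis
    proof eventually_elim
      case (elim q)
      have "(\<lambda>z. G ((\<lambda>((x, y), z). z(fst (ends e) := x, snd (ends e) := y)) (q, z)))
          \<in> borel_measurable (PiM (V - {fst (ends e), snd (ends e)}) (\<lambda>_. ?I))"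
        using ends[OF that] elim(1)
        by (intro measurable_compose[OF measurable_Pair1' measurable_compose[OF I.measurable_upd_pair G_meas]])
          auto
      then show ?case
        using elim(2) unfolding edge_rooted_density_def cube_measure_def r_def split_beta
        by (intro integral_completion_AE_cong) (auto simp: split_beta)
    qed
  qed
  have r_meas: "r e \<in> borel_measurable ?S" if "e \<in> E" for e
    unfolding r_def using ends[OF that] G_meas by (intro I.borel_measurable_rooted_integral) auto
  have "L1_norm (\<lambda>q. edge_marginal V E W (ends e) q - 1) = (LINT q|?S. \<bar>r e q / t - 1\<bar>)"
    if "e \<in> E" for e
    unfolding L1_norm_def edge_marginal_def hom using rooted[OF that] r_meas[OF that]
    by (intro integral_lebesgue_on_unit_square) auto
  then have \<Delta>: "marginal_error V E W = (\<Sum>e\<in>E. LINT q|?S. \<bar>r e q / t - 1\<bar>)"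
    by (simp add: marginal_error_def)
  then have \<Delta>0: "0 \<le> marginal_error V E W" by (simp add: sum_nonneg)
  have M0: "0 \<le> M" using assms(5,6,8) by simp
  let ?B = "1 / real m * (2 * exp (real m * M) + (real m)\<^sup>2 * M\<^sup>2) * M * marginal_error V E W"
  let ?v = "LINT z|?S. (ln (w z) - u)\<^sup>2"
  have "real m * ?v \<le> exp (real m * M) * M * marginal_error V E W"
    unfolding \<Delta> u assms(2,8) r_def t_def G_def
    by (rule I.log_variance_le_marginals[OF V E ends w assms(5) sym])
  then have "?v \<le> 1 / real m * (exp (real m * M) * (M * marginal_error V E W))"
    using assms(3) by (simp add: field_simps)
  \<comment> \<open>The factor \<open>exp (m M)\<close> is enlarged to the stated constant.\<close>
  also have "\<dots> \<le> 1 / real m * ((2 * exp (real m * M) + (real m)\<^sup>2 * M\<^sup>2) * (M * marginal_error V E W))"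
    using M0 \<Delta>0 by (intro mult_left_mono mult_right_mono) (auto simp: add_increasing2)
  finally have v: "?v \<le> ?B" by (simp add: mult_ac)
  have log_dev: "(L2_norm (\<lambda>z. ln (W z) - u))\<^sup>2 = ?v"
    using L2[of "\<lambda>s. ln s - u"] by simp
  have lnw: "- M \<le> ln (w z)" "ln (w z) \<le> 0" for z
    using w(2)[of z] wpos[of z] assms(5) by (auto simp: assms(8) ln_div)
  have u0: "u \<le> 0"
    using Bochner_Integration.integral_nonneg[of ?S "\<lambda>z. - ln (w z)"] lnw by (simp add: u)
  have lip: "\<bar>w z - p\<bar> \<le> \<bar>ln (w z) - u\<bar>" for z
    using abs_exp_diff_le[OF lnw(2)[of z] u0] wpos[of z] by (simp add: assms(10))
  have p: "0 < p" "p \<le> 1" using u0 by (auto simp: assms(10))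
  have diff: "\<bar>w z - p\<bar> \<le> 1" for z using w(2)[of z] wpos[of z] p by linarith
  have lnw_dev: "\<bar>ln (w z) - u\<bar> \<le> M + \<bar>u\<bar>" for z using lnw[of z] by linarith
  have int_sq: "integrable ?S (\<lambda>z. (w z - p)\<^sup>2)"
    using diff by (intro S.P.integrable_const_bound[where B = "1\<^sup>2"] AE_I2)
      (auto simp: abs_square_le_1)
  have "integrable ?S (\<lambda>z. (ln (w z) - u)\<^sup>2)"
  proof (intro S.P.integrable_const_bound[where B = "(M + \<bar>u\<bar>)\<^sup>2"] AE_I2)
    show "norm ((ln (w z) - u)\<^sup>2) \<le> (M + \<bar>u\<bar>)\<^sup>2" for z
      using power_mono[OF lnw_dev[of z], of 2] by simp
  qed measurable
  then have sq_dev: "(LINT z|?S. (w z - p)\<^sup>2) \<le> ?v"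
    using lip by (intro integral_mono int_sq) (simp_all flip: abs_le_square_iff)
  have "L1_norm (\<lambda>z. W z - p) = (LINT z|?S. \<bar>w z - p\<bar>)"
    unfolding L1_norm_def using eq by (intro integral_lebesgue_on_unit_square) auto
  \<comment> \<open>The difference of the two sides is the variance of \<open>\<bar>w - p\<bar>\<close>.\<close>
  moreover have "(LINT z|?S. \<bar>w z - p\<bar>)\<^sup>2 \<le> (LINT z|?S. \<bar>w z - p\<bar>\<^sup>2)"
  proof -
    have "integrable ?S (\<lambda>z. \<bar>w z - p\<bar>)"
      using diff by (intro S.P.integrable_const_bound[where B = 1] AE_I2) auto
    then show ?thesis
      using S.P.variance_eq[of "\<lambda>z. \<bar>w z - p\<bar>"] S.P.variance_positive[of "\<lambda>z. \<bar>w z - p\<bar>"] int_sq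
      by simp
  qed
  ultimately have L1_dev: "(L1_norm (\<lambda>z. W z - p))\<^sup>2 \<le> ?v" using sq_dev by simp
  have "(L2_norm (\<lambda>z. W z - p))\<^sup>2 \<le> ?v"
    using sq_dev L2[of "\<lambda>s. s - p"] by simp
  with log_dev L1_dev v show ?thesis by auto
qed

end
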